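(* Let $\{a_n\}_{n\geqslant 1}$ be a P-recursive sequence of non-negative real numbers. Suppose that there are positive integers $\rho, M$ and real numbers $\mu_0,\mu_1,\dots,\mu_\rho$, $r$, $b_0,\dots,b_M$ with \[ b_0>0 \quad\text{and}\quad M/\rho>3, \] such that, as $n\to\infty$, \[ a_n = e^{Q(\rho,n)}\, n^{r}\left(\sum_{s=0}^{M} b_s n^{-s/\rho}+o\left(n^{-M/\rho}\right)\right), \qquad Q(\rho,n)=\mu_0 n\log n+\sum_{j=1}^{\rho}\mu_j n^{j/\rho}. \] If one of the following three conditions holds, then the sequence $\{\sqrt[n]{a_n}\}_{n\geqslant 1}$ is asymptotically ratio log-convex: (1) $\mu_0>0$; (2) $\mu_0=0$, at least one of $\mu_1,\dots,\mu_{\rho-1}$ is nonzero, and $\mu_k<0$, where $k=\max\{j : 1\leqslant j\leqslant \rho-1,\ \mu_j\neq 0\}$; (3) $\mu_0=0$, $\mu_j=0$ for all $1\leqslant j\leqslant \rho-1$, and $r<0$.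
   Context: A sequence $\{a_n\}_{n\geqslant 1}$ is P-recursive (of order $d$) if there are polynomials $p_0(n),\dots,p_d(n)$ in $n$, not all zero, such that $p_0(n)a_n+p_1(n)a_{n+1}+\cdots+p_d(n)a_{n+d}=0$ for all $n\geqslant 1$. A sequence $\{c_n\}$ is log-convex if $c_n^2\leqslant c_{n+1}c_{n-1}$ for all $n$ for which the three terms are defined, and $\{c_n\}$ is ratio log-convex if $\{c_{n+1}/c_n\}$ is log-convex. The sequence $\{\sqrt[n]{a_n}\}_{n\geqslant 1}$ is asymptotically ratio log-convex if, for all sufficiently large $n$, $a_n>0$ and \[ \left(\frac{\sqrt[n+1]{a_{n+1}}}{\sqrt[n]{a_n}}\right)^2\leqslant \frac{\sqrt[n+2]{a_{n+2}}}{\sqrt[n+1]{a_{n+1}}}\cdot\frac{\sqrt[n]{a_n}}{\sqrt[n-1]{a_{n-1}}}. \] *)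

theory Defs
  imports Complex_Main "HOL-Computational_Algebra.Polynomial" "HOL-Library.Landau_Symbols"
begin

text \<open>
  A sequence indexed by the integers \<open>n \<ge> 1\<close> is a function on \<open>nat\<close> whose value at 0 is never
  used. All sequences are real, and so are the coefficients of the recurrence polynomials.
\<close>

definition P_recursive_of_order :: "nat \<Rightarrow> (nat \<Rightarrow> real) \<Rightarrow> bool" where
  "P_recursive_of_order d a \<longleftrightarrow>
     (\<exists>p :: nat \<Rightarrow> real poly.
        (\<exists>i\<le>d. p i \<noteq> 0) \<and>
        (\<forall>n\<ge>1. (\<Sum>i\<le>d. poly (p i) (real n) * a (n + i)) = 0))"

definition P_recursive :: "(nat \<Rightarrow> real) \<Rightarrow> bool" where
  "P_recursive a \<longleftrightarrow> (\<exists>d. P_recursive_of_order d a)"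

text \<open>
  The argument is \<open>a\<close> itself; the property is about the sequence \<open>root n (a n)\<close>. Only large \<open>n\<close>
  matter, so the truncated subtraction and the conventions for \<open>root 0\<close> and division by 0 play
  no role.
\<close>

definition root_asymp_ratio_log_convex :: "(nat \<Rightarrow> real) \<Rightarrow> bool" where
  "root_asymp_ratio_log_convex a \<longleftrightarrow>
     (\<forall>\<^sub>F n in sequentially.
        a n > 0 \<and>
        (root (n + 1) (a (n + 1)) / root n (a n)) ^ 2
          \<le> root (n + 2) (a (n + 2)) / root (n + 1) (a (n + 1))
            * (root n (a n) / root (n - 1) (a (n - 1))))"

definition Q_exponent :: "(nat \<Rightarrow> real) \<Rightarrow> nat \<Rightarrow> nat \<Rightarrow> real" where
  "Q_exponent \<mu> \<rho> n =
     \<mu> 0 * real n * ln (real n) + (\<Sum>j=1..\<rho>. \<mu> j * real n powr (real j / real \<rho>))"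

end

theory Submission
  imports Defs "HOL-Real_Asymp.Real_Asymp"
begin

text \<open>
  Put \<open>L n = ln (a n) / n\<close>, so that \<open>root n (a n) = exp (L n)\<close>. Taking logarithms turns the
  required inequality into nonnegativity of the third difference
  \<open>L (n + 2) - 3 L (n + 1) + 3 L n - L (n - 1)\<close>, which is linear in \<open>L\<close> and, on
  smooth functions of moderate growth, behaves like a third derivative.

  The asymptotic expansion gives, with \<open>S n\<close> the bracketed factor, which tends to \<open>b 0 > 0\<close>,
  \[ L(n) = \mu_0 \ln n + \sum_{j=1}^{\rho} \mu_j n^{j/\rho - 1} + r\,\frac{\ln n}{n}
            + \frac{\ln S(n)}{n}. \]
  The term with \<open>j = \<rho>\<close> is constant and disappears. The third differences of the others are
  \<^item> \<open>2 \<mu>\<^sub>0 n\<^sup>-\<^sup>3\<close> to leading order for the term \<open>\<mu>\<^sub>0 ln n\<close>;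
  \<^item> \<open>\<mu>\<^sub>j \<beta> (\<beta> - 1) (\<beta> - 2) n powr (\<beta> - 3)\<close> to leading order, where
    \<open>\<beta> = j / \<rho> - 1\<close>; as \<open>-1 < \<beta> < 0\<close>, the sign is opposite to that of \<open>\<mu>\<^sub>j\<close>;
  \<^item> \<open>-6 r ln n / n\<^sup>4\<close> to leading order for the term \<open>r ln n / n\<close>;
  \<^item> \<open>O(n\<^sup>-\<^sup>4)\<close> for \<open>ln (S n) / n\<close>.

  Under each of the three conditions the slowest decaying one of these contributions is
  positive: it comes from \<open>\<mu>\<^sub>0\<close>, from \<open>\<mu>\<^sub>k\<close> and from \<open>r\<close> respectively.

  Only the last item needs an argument, since \<open>S\<close> contains an error term about whose differences
  nothing is known beyond its size. The logarithm of a polynomial in \<open>n powr (-1/\<rho>)\<close> with positive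
  constant term is again such a polynomial up to an arbitrarily small power
  (\<open>ln_poly_expansion\<close>), so \<open>ln (S n) / n\<close> is a finite combination of powers with exponents at
  most \<open>-1\<close>, each with third difference \<open>O(n\<^sup>-\<^sup>4)\<close>, plus an error
  \<open>o(n powr (- M/\<rho> - 1))\<close>. The hypothesis \<open>M/\<rho> > 3\<close> makes this error \<open>o(n\<^sup>-\<^sup>4)\<close>, and a third
  difference is a combination of four shifts, so it preserves that bound
  (\<open>D3_smallo\<close>).
\<close>

section \<open>Third differences\<close>

text \<open>
  The indexing is centred so that the four terms are those of the ratio inequality at \<open>n\<close>.
\<close>

definition D3 :: "(nat \<Rightarrow> real) \<Rightarrow> nat \<Rightarrow> real" where
  "D3 f n = f (n + 2) - 3 * f (n + 1) + 3 * f n - f (n - 1)"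

lemma D3_add: "D3 (\<lambda>n. f n + g n) n = D3 f n + D3 g n"
  by (simp add: D3_def algebra_simps)

lemma D3_cmult: "D3 (\<lambda>n. c * f n) n = c * D3 f n"
  by (simp add: D3_def algebra_simps)

lemma D3_sum: "D3 (\<lambda>n. \<Sum>i\<in>A. f i n) n = (\<Sum>i\<in>A. D3 (f i) n)"
  by (simp add: D3_def sum.distrib sum_subtractf sum_distrib_left)

lemma D3_const: "D3 (\<lambda>n. c) n = 0"
  by (simp add: D3_def)

lemma D3_eventually_cong:
  assumes "\<forall>\<^sub>F n in sequentially. f n = g n"
  shows "\<forall>\<^sub>F n in sequentially. D3 f n = D3 g n"
proof -
  from assms obtain N where "\<And>n. n \<ge> N \<Longrightarrow> f n = g n"
    unfolding eventually_sequentially by blast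
  then show ?thesis
    by (intro eventually_sequentiallyI[of "N + 1"]) (simp add: D3_def)
qed

text \<open>
  Passing to a real variable removes the truncated subtraction in \<open>n - 1\<close>; the limits of explicit
  functions below then become expansions at infinity.
\<close>

lemma D3_tendsto_of_real_limit:
  assumes "((\<lambda>x. (F (x + 2) - 3 * F (x + 1) + 3 * F x - F (x - 1)) / \<phi> x) \<longlongrightarrow> c) at_top"
  shows "(\<lambda>n. D3 (\<lambda>n. F (real n)) n / \<phi> (real n)) \<longlonglongrightarrow> c"
proof -
  let ?G = "\<lambda>x. (F (x + 2) - 3 * F (x + 1) + 3 * F x - F (x - 1)) / \<phi> x"
  have "(\<lambda>n. ?G (real n)) \<longlonglongrightarrow> c"
    by (rule filterlim_compose[OF assms filterlim_real_sequentially])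
  moreover have "\<forall>\<^sub>F n in sequentially.
      ?G (real n) = D3 (\<lambda>n. F (real n)) n / \<phi> (real n)"
    using eventually_ge_at_top[of 1]
    by eventually_elim (simp add: D3_def of_nat_diff add.commute)
  ultimately show ?thesis by (rule Lim_transform_eventually)
qed

lemma D3_ln: "(\<lambda>n. D3 (\<lambda>n. ln (real n)) n / real n powr -3) \<longlonglongrightarrow> 2"
  by (rule D3_tendsto_of_real_limit[where \<phi> = "\<lambda>x. x powr -3"]) real_asymp

lemma D3_ln_over_id:
  "(\<lambda>n. D3 (\<lambda>n. ln (real n) / real n) n / (ln (real n) * real n powr -4)) \<longlonglongrightarrow> -6"
  by (rule D3_tendsto_of_real_limit[where F = "\<lambda>x. ln x / x" and \<phi> = "\<lambda>x. ln x * x powr -4"])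
    real_asymp

lemma D3_powr:
  "(\<lambda>n. D3 (\<lambda>n. real n powr \<beta>) n / real n powr (\<beta> - 3)) \<longlonglongrightarrow> \<beta> * (\<beta> - 1) * (\<beta> - 2)"
  by (rule D3_tendsto_of_real_limit[where \<phi> = "\<lambda>x. x powr (\<beta> - 3)"]) real_asymp

lemma D3_ln_over_id_bigo:
  "D3 (\<lambda>n. ln (real n) / real n) \<in> O(\<lambda>n. ln (real n) * real n powr -4)"
  by (rule bigoI_tendsto[OF D3_ln_over_id], rule eventually_mono[OF eventually_gt_at_top[of 1]]) simp

lemma D3_powr_bigo: "D3 (\<lambda>n. real n powr \<beta>) \<in> O(\<lambda>n. real n powr (\<beta> - 3))"
  by (rule bigoI_tendsto[OF D3_powr], rule eventually_mono[OF eventually_gt_at_top[of 1]]) simp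

text \<open>
  No regularity of \<open>f\<close> is available here, so nothing is gained by differencing; nothing is lost
  either, because a shift does not change the order of a power.
\<close>

lemma D3_smallo:
  assumes "f \<in> o(\<lambda>n. real n powr e)"
  shows "D3 f \<in> o(\<lambda>n. real n powr e)"
proof -
  have up: "(\<lambda>n. f (n + k)) \<in> o(\<lambda>n. real n powr e)" for k
  proof -
    have "(\<lambda>n. f (n + k)) \<in> o(\<lambda>n. real (n + k) powr e)"
      by (rule landau_o.small.compose[OF assms]) real_asymp
    also have "(\<lambda>n. real (n + k) powr e) \<in> O(\<lambda>n. real n powr e)"
      by real_asymp
    finally show ?thesis .
  qed
  have "(\<lambda>n. f (n - 1)) \<in> o(\<lambda>n. real (n - 1) powr e)"
    by (rule landau_o.small.compose[OF assms filterlim_minus_const_nat_at_top])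
  also have "(\<lambda>n. real (n - 1) powr e) \<in> O(\<lambda>n. real n powr e)"
  proof -
    have "(\<lambda>n. (real n - 1) powr e) \<in> O(\<lambda>n. real n powr e)"
      by real_asymp
    moreover have "\<forall>\<^sub>F n in sequentially. (real n - 1) powr e = real (n - 1) powr e"
      using eventually_ge_at_top[of 1] by eventually_elim (simp add: of_nat_diff)
    ultimately show ?thesis by (subst (asm) landau_o.big.in_cong)
  qed
  finally have down: "(\<lambda>n. f (n - 1)) \<in> o(\<lambda>n. real n powr e)" .
  have "(\<lambda>n. f (n + 2) - 3 * f (n + 1) + 3 * f n - f (n - 1)) \<in> o(\<lambda>n. real n powr e)"
    using up[of 2] up[of 1] assms down
    by (intro sum_in_smallo) (auto intro: landau_o.small.cmult_in_iff[THEN iffD2])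
  then show ?thesis by (simp add: D3_def[abs_def])
qed

section \<open>Ratio log-convexity as a third difference\<close>

lemma exp_ratio_iff_D3_nonneg:
  assumes "n \<ge> 2" "a (n - 1) > 0" "a n > 0" "a (n + 1) > 0" "a (n + 2) > 0"
  shows "(root (n + 1) (a (n + 1)) / root n (a n)) ^ 2
          \<le> root (n + 2) (a (n + 2)) / root (n + 1) (a (n + 1))
            * (root n (a n) / root (n - 1) (a (n - 1)))
     \<longleftrightarrow> D3 (\<lambda>n. ln (a n) / real n) n \<ge> 0"
proof -
  define L where "L = (\<lambda>n. ln (a n) / real n)"
  have root_eq: "root m (a m) = exp (L m)" if "m > 0" "a m > 0" for m
    using that by (simp add: L_def root_powr_inverse powr_def divide_inverse mult.commute)
  have "(root (n + 1) (a (n + 1)) / root n (a n)) ^ 2 = exp (2 * (L (n + 1) - L n))"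
    using assms root_eq[of "n + 1"] root_eq[of n]
    by (simp add: exp_diff exp_double[symmetric] power_divide exp_of_nat_mult[symmetric]
        power2_eq_square flip: exp_add)
  moreover have "root (n + 2) (a (n + 2)) / root (n + 1) (a (n + 1))
            * (root n (a n) / root (n - 1) (a (n - 1)))
      = exp (L (n + 2) - L (n + 1) + (L n - L (n - 1)))"
    using assms root_eq[of "n + 1"] root_eq[of n] root_eq[of "n + 2"] root_eq[of "n - 1"]
    by (simp add: exp_diff exp_add)
  ultimately show ?thesis by (simp add: D3_def L_def algebra_simps)
qed

lemma root_asymp_ratio_log_convexI:
  assumes pos: "\<forall>\<^sub>F n in sequentially. a n > 0"
    and D3: "\<forall>\<^sub>F n in sequentially. D3 (\<lambda>n. ln (a n) / real n) n \<ge> 0"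
  shows "root_asymp_ratio_log_convex a"
proof -
  from pos obtain N where N: "\<And>n. n \<ge> N \<Longrightarrow> a n > 0"
    unfolding eventually_sequentially by blast
  show ?thesis
    unfolding root_asymp_ratio_log_convex_def
    using D3 eventually_ge_at_top[of "N + 2"]
  proof eventually_elim
    case (elim n)
    then show ?case
      using exp_ratio_iff_D3_nonneg[of n a] N[of n] N[of "n - 1"] N[of "n + 1"] N[of "n + 2"]
      by simp
  qed
qed

section \<open>The logarithm of a polynomial\<close>

text \<open>
  For \<open>\<bar>u\<bar> \<le> 1/2\<close> the tail of the logarithmic series from \<open>N\<close> on is dominated by
  the geometric series with first term \<open>\<bar>u\<bar> ^ N\<close> and ratio \<open>1/2\<close>. The summand at \<open>k = 0\<close>
  vanishes by the convention for division by zero.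
\<close>

lemma ln_one_plus_taylor_bound:
  fixes u :: real
  assumes "\<bar>u\<bar> \<le> 1/2"
  shows "\<bar>ln (1 + u) - (\<Sum>k<N. - ((- u) ^ k) / real k)\<bar> \<le> 2 * \<bar>u\<bar> ^ N"
proof -
  let ?f = "\<lambda>k. - ((- u) ^ k) / real k"
  have "?f sums ln (1 + u)"
    using assms by (intro ln_series') auto
  then have tail: "(\<lambda>k. ?f (k + N)) sums (ln (1 + u) - (\<Sum>k<N. ?f k))"
    by (rule sums_split_initial_segment)
  have "(\<lambda>k. (1/2::real) ^ k) sums 2"
    using geometric_sums[of "1/2::real"] by simp
  then have geo: "(\<lambda>k. \<bar>u\<bar> ^ N * (1/2) ^ k) sums (\<bar>u\<bar> ^ N * 2)"
    by (rule sums_mult)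
  have "norm (?f (k + N)) \<le> \<bar>u\<bar> ^ N * (1/2) ^ k" for k
  proof -
    have "norm (?f (k + N)) \<le> \<bar>u\<bar> ^ (k + N)"
      by (cases "k + N = 0") (auto simp: power_abs divide_simps mult_le_cancel_left1 simp del: of_nat_add)
    also have "\<dots> \<le> \<bar>u\<bar> ^ N * (1/2) ^ k"
      using power_mono[OF assms, of k] by (simp add: power_add mult.commute mult_left_mono)
    finally show ?thesis .
  qed
  then have "norm (ln (1 + u) - (\<Sum>k<N. ?f k)) \<le> \<bar>u\<bar> ^ N * 2"
    by (rule norm_sums_le[OF tail geo])
  then show ?thesis by (simp add: mult.commute)
qed

text \<open>
  Write \<open>p = c (1 + U)\<close> with \<open>c = p(0)\<close>. Truncating the logarithmic series at \<open>U\<close> gives a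
  polynomial with error \<open>O(U ^ N)\<close>, and \<open>U\<close> is divisible by \<open>t\<close>. Terms of \<open>q\<close>
  of degree \<open>N\<close> and higher may occur; they do not affect the estimate.
\<close>

lemma ln_poly_expansion:
  fixes p :: "real poly"
  assumes "poly p 0 > 0"
  shows "\<exists>q. (\<lambda>t. ln (poly p t) - poly q t) \<in> O[at 0](\<lambda>t. t ^ N)"
proof -
  define c where "c = poly p 0"
  define U where "U = smult (1 / c) p - 1"
  define q where "q = [:ln c:] + (\<Sum>k<N. smult (- 1 / real k) ((- U) ^ k))"
  have c: "c > 0" using assms by (simp add: c_def)
  have poly_p: "poly p t = c * (1 + poly U t)" for t
    using c by (simp add: U_def)
  have poly_q: "poly q t = ln c + (\<Sum>k<N. - ((- poly U t) ^ k) / real k)" for t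
    by (simp add: q_def poly_sum)
  have U0: "poly U 0 = 0" using c by (simp add: U_def c_def)
  have "[:0, 1:] dvd U" using U0 by (simp add: dvd_iff_poly_eq_0)
  then obtain R where R: "U = [:0, 1:] * R" by (elim dvdE)
  have cont: "poly V \<midarrow>0\<rightarrow> poly V 0" for V :: "real poly"
    using poly_isCont by (simp add: isCont_def)
  have lim: "poly U \<midarrow>0\<rightarrow> 0"
    using cont[of U] U0 by simp
  have "\<forall>\<^sub>F t in at 0. \<bar>poly U t\<bar> < 1/2"
    using tendstoD[OF lim, of "1/2"] by (simp add: dist_real_def)
  then have "\<forall>\<^sub>F t in at 0. norm (ln (poly p t) - poly q t) \<le> 2 * norm (poly U t ^ N)"
  proof eventually_elim
    case (elim t)
    have "ln (poly p t) = ln c + ln (1 + poly U t)"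
      unfolding poly_p using c elim by (intro ln_mult_pos) auto
    then show ?case
      using ln_one_plus_taylor_bound[of "poly U t" N] elim
      by (simp add: poly_q power_abs)
  qed
  then have "(\<lambda>t. ln (poly p t) - poly q t) \<in> O[at 0](\<lambda>t. poly U t ^ N)"
    by (rule bigoI)
  also have "(\<lambda>t. poly U t ^ N) \<in> O[at 0](\<lambda>t. t ^ N)"
  proof (rule landau_o.big_power)
    have "poly R \<in> O[at 0](\<lambda>_. 1)"
      using cont[of R] by (intro bigoI_tendsto[where c = "poly R 0"]) auto
    from landau_o.big.mult[OF landau_o.big_refl this, of "\<lambda>t. t"]
    have "(\<lambda>t. t * poly R t) \<in> O[at 0](\<lambda>t. t)" by simp
    moreover have "poly U = (\<lambda>t. t * poly R t)" by (simp add: R fun_eq_iff)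
    ultimately show "poly U \<in> O[at 0](\<lambda>t. t)" by simp
  qed
  finally show ?thesis by blast
qed

section \<open>The logarithm of the bracketed factor\<close>

text \<open>
  With \<open>t = n powr (-1/\<rho>)\<close> the main part \<open>P\<close> of \<open>S\<close> is a polynomial in \<open>t\<close>, to which
  \<open>ln_poly_expansion\<close> applies. The perturbation costs
  \<open>ln (S n) - ln (P n) = ln (1 + \<epsilon> n / P n) = O(\<epsilon> n)\<close>, because \<open>P\<close> stays away from zero.
\<close>

lemma ln_puiseux_expansion:
  fixes b :: "nat \<Rightarrow> real" and \<epsilon> :: "nat \<Rightarrow> real"
  assumes "\<rho> > 0" and "b 0 > 0"
    and \<epsilon>: "\<epsilon> \<in> o(\<lambda>n. real n powr (- (real M / real \<rho>)))"
  defines "S \<equiv> \<lambda>n. (\<Sum>s=0..M. b s * real n powr (- (real s / real \<rho>))) + \<epsilon> n"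
  shows "S \<longlonglongrightarrow> b 0"
    and "\<exists>c K. (\<lambda>n. ln (S n) - (\<Sum>i\<le>K. c i * real n powr (- (real i / real \<rho>))))
               \<in> o(\<lambda>n. real n powr (- (real M / real \<rho>)))"
proof -
  define t where "t = (\<lambda>n::nat. real n powr (- (1 / real \<rho>)))"
  define p where "p = (\<Sum>s=0..M. monom (b s) s)"
  define P where "P = (\<lambda>n. poly p (t n))"
  have t_pow: "t n ^ i = real n powr (- (real i / real \<rho>))" if "n \<ge> 1" for n i
    using that by (simp add: t_def powr_powr powr_realpow[symmetric])
  have t_lim: "t \<longlonglongrightarrow> 0" using \<open>\<rho> > 0\<close> unfolding t_def by real_asymp
  have "\<forall>\<^sub>F n in sequentially. t n \<noteq> 0"
    using eventually_ge_at_top[of 1] by eventually_elim (simp add: t_def)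
  with t_lim have t_at: "filterlim t (at 0) sequentially"
    by (simp add: filterlim_at)
  have S_eq: "\<forall>\<^sub>F n in sequentially. P n + \<epsilon> n = S n"
    using eventually_ge_at_top[of 1]
    by eventually_elim (simp add: S_def P_def p_def poly_sum poly_monom t_pow)
  have p0: "poly p 0 = b 0"
    by (simp add: p_def poly_sum poly_monom power_0_left if_distrib cong: if_cong)
  have P_lim: "P \<longlonglongrightarrow> b 0"
    unfolding P_def p0[symmetric] by (rule isCont_tendsto_compose[OF poly_isCont t_lim])
  have "(\<lambda>n. real n powr (- (real M / real \<rho>))) \<in> O(\<lambda>_. 1)"
    using \<open>\<rho> > 0\<close> by (intro bigoI[where c = 1] eventually_mono[OF eventually_ge_at_top[of 1]])
      (simp add: powr_minus divide_simps ge_one_powr_ge_zero)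
  from landau_o.small_big_trans[OF \<epsilon> this] have \<epsilon>_lim: "\<epsilon> \<longlonglongrightarrow> 0"
    by (auto dest: smalloD_tendsto)
  show S_lim: "S \<longlonglongrightarrow> b 0"
    using tendsto_add[OF P_lim \<epsilon>_lim] Lim_transform_eventually[OF _ S_eq] by simp
  \<comment> \<open>Order \<open>M + 1\<close> is what makes the Taylor error small compared with \<open>t ^ M\<close>.\<close>
  obtain q where q: "(\<lambda>t. ln (poly p t) - poly q t) \<in> O[at 0](\<lambda>t. t ^ Suc M)"
    using ln_poly_expansion[of p "Suc M"] p0 \<open>b 0 > 0\<close> by auto
  have "(\<lambda>n. ln (P n) - poly q (t n)) \<in> O(\<lambda>n. t n ^ Suc M)"
    unfolding P_def by (rule landau_o.big.compose[OF q t_at])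
  also have "(\<lambda>n. t n ^ Suc M) \<in> o(\<lambda>n. real n powr (- (real M / real \<rho>)))"
  proof -
    have "(\<lambda>n. t n ^ M * t n) \<in> o(\<lambda>n. t n ^ M * 1)"
      using t_lim by (intro landau_o.big_small_mult) (auto intro: smalloI_tendsto)
    moreover have "\<forall>\<^sub>F n in sequentially. t n ^ M * 1 = real n powr (- (real M / real \<rho>))"
      using eventually_ge_at_top[of 1] by eventually_elim (simp add: t_pow)
    ultimately show ?thesis
      by (subst (asm) landau_o.small.cong) (simp_all add: mult.commute)
  qed
  finally have ln_P: "(\<lambda>n. ln (P n) - poly q (t n)) \<in> o(\<lambda>n. real n powr (- (real M / real \<rho>)))" .
  have ln_S: "(\<lambda>n. ln (S n) - ln (P n)) \<in> o(\<lambda>n. real n powr (- (real M / real \<rho>)))"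
  proof -
    have ratio: "(\<lambda>n. \<epsilon> n / P n) \<longlonglongrightarrow> 0"
      using tendsto_divide[OF \<epsilon>_lim P_lim] \<open>b 0 > 0\<close> by simp
    have "\<forall>\<^sub>F n in sequentially. P n > b 0 / 2"
      using P_lim \<open>b 0 > 0\<close> by (intro order_tendstoD) auto
    moreover have "\<forall>\<^sub>F n in sequentially. \<bar>\<epsilon> n / P n\<bar> < 1 / 2"
      using tendstoD[OF ratio, of "1/2"] by (simp add: dist_real_def)
    ultimately have "\<forall>\<^sub>F n in sequentially. norm (ln (S n) - ln (P n)) \<le> 4 / b 0 * norm (\<epsilon> n)"
      using S_eq
    proof eventually_elim
      case (elim n)
      have Pn: "P n > 0" using elim \<open>b 0 > 0\<close> by linarith
      have "S n = P n * (1 + \<epsilon> n / P n)" using Pn elim by (simp add: field_simps)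
      moreover have "1 + \<epsilon> n / P n > 0" using elim by linarith
      ultimately have "ln (S n) - ln (P n) = ln (1 + \<epsilon> n / P n)"
        using Pn by (simp add: ln_mult_pos)
      \<comment> \<open>At order 1 the Taylor sum consists of its vanishing summand only.\<close>
      also have "norm \<dots> \<le> 2 * \<bar>\<epsilon> n / P n\<bar>"
        using ln_one_plus_taylor_bound[of "\<epsilon> n / P n" 1] elim by simp
      also have "\<bar>\<epsilon> n / P n\<bar> = \<bar>\<epsilon> n\<bar> / P n"
        using Pn by simp
      also have "\<bar>\<epsilon> n\<bar> / P n \<le> \<bar>\<epsilon> n\<bar> / (b 0 / 2)"
        using elim \<open>b 0 > 0\<close> Pn by (intro divide_left_mono) auto
      finally show ?case by simp
    qed
    then have "(\<lambda>n. ln (S n) - ln (P n)) \<in> O(\<epsilon>)" by (rule bigoI)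
    from landau_o.big_small_trans[OF this \<epsilon>] show ?thesis .
  qed
  have "(\<lambda>n. (ln (S n) - ln (P n)) + (ln (P n) - poly q (t n)))
      \<in> o(\<lambda>n. real n powr (- (real M / real \<rho>)))"
    by (rule sum_in_smallo[OF ln_S ln_P])
  moreover have "\<forall>\<^sub>F n in sequentially. (ln (S n) - ln (P n)) + (ln (P n) - poly q (t n))
      = ln (S n) - (\<Sum>i\<le>degree q. coeff q i * real n powr (- (real i / real \<rho>)))"
    using eventually_ge_at_top[of 1] by eventually_elim (simp add: poly_altdef t_pow)
  ultimately have "(\<lambda>n. ln (S n) - (\<Sum>i\<le>degree q. coeff q i * real n powr (- (real i / real \<rho>))))
               \<in> o(\<lambda>n. real n powr (- (real M / real \<rho>)))"
    by (subst (asm) landau_o.small.in_cong)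
  then show "\<exists>c K. (\<lambda>n. ln (S n) - (\<Sum>i\<le>K. c i * real n powr (- (real i / real \<rho>))))
               \<in> o(\<lambda>n. real n powr (- (real M / real \<rho>)))" by blast
qed

text \<open>
  Division by \<open>n\<close> lowers every exponent by one: the powers become smooth terms of exponent at most
  \<open>-1\<close>, which gain three orders under \<open>D3\<close>, whereas the remainder gains none and is small enough
  only because \<open>M/\<rho> + 1 > 4\<close>.
\<close>

lemma D3_ln_puiseux_over_id_bigo:
  fixes l :: "nat \<Rightarrow> real"
  assumes "\<rho> > 0" and "real M / real \<rho> > 3"
    and l: "(\<lambda>n. l n - (\<Sum>i\<le>K. c i * real n powr (- (real i / real \<rho>))))
              \<in> o(\<lambda>n. real n powr (- (real M / real \<rho>)))"
  shows "D3 (\<lambda>n. l n / real n) \<in> O(\<lambda>n. real n powr -4)"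
proof -
  let ?T = "\<lambda>n. \<Sum>i\<le>K. c i * real n powr (- (real i / real \<rho>))"
  let ?T' = "\<lambda>n. \<Sum>i\<le>K. c i * real n powr (- (real i / real \<rho>) - 1)"
  have T: "(\<lambda>n. D3 (\<lambda>n. ?T' n) n) \<in> O(\<lambda>n. real n powr -4)"
    unfolding D3_sum D3_cmult
  proof (intro big_sum_in_bigo)
    fix i assume "i \<in> {..K}"
    have "D3 (\<lambda>n. real n powr (- (real i / real \<rho>) - 1)) \<in> O(\<lambda>n. real n powr (- (real i / real \<rho>) - 1 - 3))"
      by (rule D3_powr_bigo)
    also have "(\<lambda>n. real n powr (- (real i / real \<rho>) - 1 - 3)) \<in> O(\<lambda>n. real n powr -4)"
      by (intro bigoI[where c = 1] eventually_mono[OF eventually_ge_at_top[of 1]]) (auto intro!: powr_mono)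
    finally show "(\<lambda>n. c i * D3 (\<lambda>n. real n powr (- (real i / real \<rho>) - 1)) n) \<in> O(\<lambda>n. real n powr -4)"
      by (cases "c i = 0") simp_all
  qed
  have "(\<lambda>n. (l n - ?T n) / real n) \<in> o(\<lambda>n. real n powr (- (real M / real \<rho>)) / real n)"
    using l by (intro landau_o.small.divide_right) (auto intro: eventually_mono[OF eventually_ge_at_top[of 1]])
  also have "(\<lambda>n. real n powr (- (real M / real \<rho>)) / real n) \<in> O(\<lambda>n. real n powr -4)"
  proof (intro bigoI[where c = 1] eventually_mono[OF eventually_ge_at_top[of 1]])
    fix n :: nat assume "n \<ge> 1"
    then have "real n powr (- (real M / real \<rho>)) / real n = real n powr (- (real M / real \<rho>) - 1)"
      by (simp add: powr_diff)
    also have "\<dots> \<le> real n powr -4"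
      using assms \<open>n \<ge> 1\<close> by (intro powr_mono) auto
    finally show "norm (real n powr (- (real M / real \<rho>)) / real n) \<le> 1 * norm (real n powr -4)"
      by simp
  qed
  finally have "D3 (\<lambda>n. (l n - ?T n) / real n) \<in> o(\<lambda>n. real n powr -4)"
    by (rule D3_smallo)
  from landau_o.small_imp_big[OF this] T
  have "(\<lambda>n. D3 (\<lambda>n. (l n - ?T n) / real n) n + D3 ?T' n) \<in> O(\<lambda>n. real n powr -4)"
    by (rule sum_in_bigo)
  moreover have "\<forall>\<^sub>F n in sequentially. (l n - ?T n) / real n + ?T' n = l n / real n"
    using eventually_ge_at_top[of 1]
    by eventually_elim (simp add: diff_divide_distrib sum_divide_distrib powr_diff)
  note D3_eventually_cong[OF this, unfolded D3_add]
  ultimately show ?thesis by (subst (asm) landau_o.big.in_cong)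
qed

section \<open>Comparison of the leading terms\<close>

lemma eventually_nonneg_of_dominant:
  fixes f g \<phi> :: "nat \<Rightarrow> real"
  assumes "(\<lambda>n. f n / \<phi> n) \<longlonglongrightarrow> c" and "c > 0" and "\<forall>\<^sub>F n in sequentially. \<phi> n > 0"
    and "g \<in> o(\<phi>)"
  shows "\<forall>\<^sub>F n in sequentially. f n + g n \<ge> 0"
proof -
  have "(\<lambda>n. f n / \<phi> n + g n / \<phi> n) \<longlonglongrightarrow> c + 0"
    by (rule tendsto_add[OF assms(1) smalloD_tendsto[OF assms(4)]])
  then have "\<forall>\<^sub>F n in sequentially. f n / \<phi> n + g n / \<phi> n > 0"
    using \<open>c > 0\<close> by (intro order_tendstoD(1)[where y = "c + 0"]) auto
  with assms(3) show ?thesis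
    by eventually_elim (simp add: add_divide_distrib[symmetric] zero_less_divide_iff)
qed

theorem theorem2p2:
  fixes a :: "nat \<Rightarrow> real" and \<mu> b :: "nat \<Rightarrow> real" and r :: real and \<rho> M :: nat
  assumes "P_recursive a"
    and "\<And>n. n \<ge> 1 \<Longrightarrow> a n \<ge> 0"
    and "\<rho> > 0" and "M > 0"
    and "b 0 > 0" and "real M / real \<rho> > 3"
    and "\<exists>\<epsilon> :: nat \<Rightarrow> real.
           \<epsilon> \<in> o(\<lambda>n. real n powr (- (real M / real \<rho>))) \<and>
           (\<forall>\<^sub>F n in sequentially.
              a n = exp (Q_exponent \<mu> \<rho> n) * real n powr r *
                    ((\<Sum>s=0..M. b s * real n powr (- (real s / real \<rho>))) + \<epsilon> n))"
    and "\<mu> 0 > 0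
       \<or> (\<mu> 0 = 0 \<and> (\<exists>j\<in>{1..\<rho> - 1}. \<mu> j \<noteq> 0)
            \<and> \<mu> (Max {j. 1 \<le> j \<and> j \<le> \<rho> - 1 \<and> \<mu> j \<noteq> 0}) < 0)
       \<or> (\<mu> 0 = 0 \<and> (\<forall>j\<in>{1..\<rho> - 1}. \<mu> j = 0) \<and> r < 0)"
  shows "root_asymp_ratio_log_convex a"
proof -
  from assms(7) obtain \<epsilon> where \<epsilon>: "\<epsilon> \<in> o(\<lambda>n. real n powr (- (real M / real \<rho>)))"
    and a_eq: "\<forall>\<^sub>F n in sequentially.
              a n = exp (Q_exponent \<mu> \<rho> n) * real n powr r *
                    ((\<Sum>s=0..M. b s * real n powr (- (real s / real \<rho>))) + \<epsilon> n)"
    by blast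
  define S where "S = (\<lambda>n. (\<Sum>s=0..M. b s * real n powr (- (real s / real \<rho>))) + \<epsilon> n)"
  have S_lim: "S \<longlonglongrightarrow> b 0"
    unfolding S_def by (rule ln_puiseux_expansion(1)[where b = b, OF assms(3,5) \<epsilon>])
  obtain c K where ln_S: "(\<lambda>n. ln (S n) - (\<Sum>i\<le>K. c i * real n powr (- (real i / real \<rho>))))
      \<in> o(\<lambda>n. real n powr (- (real M / real \<rho>)))"
    using ln_puiseux_expansion(2)[where b = b, OF assms(3,5) \<epsilon>] unfolding S_def by blast
  have S_pos: "\<forall>\<^sub>F n in sequentially. S n > 0"
    using S_lim assms(5) by (rule order_tendstoD)
  have a_pos: "\<forall>\<^sub>F n in sequentially. a n > 0"
    using a_eq S_pos eventually_ge_at_top[of 1]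
    by eventually_elim (simp add: S_def)

  \<comment> \<open>The third differences of the four kinds of terms in \<open>ln (a n) / n\<close>; the constant
      contributed by \<open>\<mu> \<rho>\<close> has none, which is why \<open>j\<close> stops before \<open>\<rho>\<close> below.\<close>
  define W where "W = (\<lambda>j. D3 (\<lambda>n. real n powr (real j / real \<rho> - 1)))"
  define X where "X = D3 (\<lambda>n. ln (real n))"
  define Y where "Y = D3 (\<lambda>n. ln (real n) / real n)"
  define Z where "Z = D3 (\<lambda>n. ln (S n) / real n)"
  have "\<forall>\<^sub>F n in sequentially. ln (a n) / real n =
      ((\<mu> 0 * ln (real n) + (\<Sum>j\<in>{1..<\<rho>}. \<mu> j * real n powr (real j / real \<rho> - 1)))
        + r * (ln (real n) / real n)) + (ln (S n) / real n + \<mu> \<rho>)"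
    using a_eq S_pos eventually_ge_at_top[of 1]
  proof eventually_elim
    case (elim n)
    have "{1..\<rho>} = insert \<rho> {1..<\<rho>}" using assms(3) by auto
    then have "Q_exponent \<mu> \<rho> n = \<mu> 0 * real n * ln (real n)
        + (\<Sum>j\<in>{1..<\<rho>}. \<mu> j * real n powr (real j / real \<rho>)) + \<mu> \<rho> * real n"
      using assms(3) elim by (simp add: Q_exponent_def)
    moreover have "ln (a n) = Q_exponent \<mu> \<rho> n + r * ln (real n) + ln (S n)"
    proof -
      have "a n = exp (Q_exponent \<mu> \<rho> n) * real n powr r * S n"
        using elim(1) by (simp only: S_def)
      then show ?thesis using elim(2,3) by (simp add: ln_mult_pos ln_powr)
    qed
    ultimately show ?case
      using elim by (simp add: add_divide_distrib sum_divide_distrib powr_diff)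
  qed
  from D3_eventually_cong[OF this]
  have D3_a: "\<forall>\<^sub>F n in sequentially. D3 (\<lambda>n. ln (a n) / real n) n
      = \<mu> 0 * X n + (\<Sum>j\<in>{1..<\<rho>}. \<mu> j * W j n) + r * Y n + Z n"
    unfolding D3_add D3_sum D3_cmult D3_const W_def X_def Y_def Z_def by simp

  have W: "W j \<in> O(\<lambda>n. real n powr (real j / real \<rho> - 1 - 3))" for j
    unfolding W_def by (rule D3_powr_bigo)
  have Y: "Y \<in> O(\<lambda>n. ln (real n) * real n powr -4)"
    unfolding Y_def by (rule D3_ln_over_id_bigo)
  have Z: "Z \<in> O(\<lambda>n. real n powr -4)"
    unfolding Z_def by (rule D3_ln_puiseux_over_id_bigo[OF assms(3,6) ln_S])

  have nonneg: "\<forall>\<^sub>F n in sequentially. D3 (\<lambda>n. ln (a n) / real n) n \<ge> 0"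
    if dom: "(\<lambda>n. f n / \<phi> n) \<longlonglongrightarrow> l" "l > 0" "\<forall>\<^sub>F n in sequentially. \<phi> n > 0" "g \<in> o(\<phi>)"
      and split: "\<And>n. \<mu> 0 * X n + (\<Sum>j\<in>{1..<\<rho>}. \<mu> j * W j n) + r * Y n + Z n = f n + g n"
    for f g \<phi> :: "nat \<Rightarrow> real" and l
    using eventually_nonneg_of_dominant[OF dom] D3_a
    by eventually_elim (simp only: split)

  have powr_less: "(\<lambda>n. real n powr e) \<in> o(\<lambda>n. real n powr e')" if "e < e'" for e e'
    using that by real_asymp
  have powr_pos: "\<forall>\<^sub>F n in sequentially. real n powr e > 0" for e
    using eventually_gt_at_top[of "1::nat"] by eventually_elim simp

  from assms(8) have "\<forall>\<^sub>F n in sequentially. D3 (\<lambda>n. ln (a n) / real n) n \<ge> 0"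
  proof (elim disjE conjE)
    \<comment> \<open>The logarithm dominates: each \<open>j / \<rho> - 1\<close> is negative, so \<open>W j\<close> decays faster
        than \<open>n powr -3\<close>.\<close>
    assume pos: "\<mu> 0 > 0"
    have lim: "(\<lambda>n. \<mu> 0 * X n / real n powr -3) \<longlonglongrightarrow> \<mu> 0 * 2"
      using tendsto_mult_left[OF D3_ln] by (simp add: X_def)
    have "W j \<in> o(\<lambda>n. real n powr -3)" if "j \<in> {1..<\<rho>}" for j
      by (rule landau_o.big_small_trans[OF W powr_less]) (use that in simp)
    then have "(\<lambda>n. \<Sum>j\<in>{1..<\<rho>}. \<mu> j * W j n) \<in> o(\<lambda>n. real n powr -3)"
      by (intro big_sum_in_smallo) simp
    moreover have "(\<lambda>n. r * Y n) \<in> o(\<lambda>n. real n powr -3)"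
    proof -
      have "(\<lambda>n. ln (real n) * real n powr -4) \<in> o(\<lambda>n. real n powr -3)" by real_asymp
      from landau_o.big_small_trans[OF Y this] show ?thesis by simp
    qed
    moreover have "Z \<in> o(\<lambda>n. real n powr -3)"
      by (rule landau_o.big_small_trans[OF Z powr_less]) simp
    ultimately have "(\<lambda>n. (\<Sum>j\<in>{1..<\<rho>}. \<mu> j * W j n) + r * Y n + Z n) \<in> o(\<lambda>n. real n powr -3)"
      by (intro sum_in_smallo)
    from nonneg[OF lim _ powr_pos this] show ?thesis using pos by simp
  next
    assume \<mu>0: "\<mu> 0 = 0" and ex: "\<exists>j\<in>{1..\<rho> - 1}. \<mu> j \<noteq> 0"
    define J where "J = {j. 1 \<le> j \<and> j \<le> \<rho> - 1 \<and> \<mu> j \<noteq> 0}"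
    define k where "k = Max J"
    assume "\<mu> (Max {j. 1 \<le> j \<and> j \<le> \<rho> - 1 \<and> \<mu> j \<noteq> 0}) < 0"
    then have neg: "\<mu> k < 0" by (simp add: k_def J_def)
    have "finite J" by (rule finite_subset[of _ "{..\<rho>}"]) (auto simp: J_def)
    moreover have "J \<noteq> {}" using ex by (auto simp: J_def)
    ultimately have kJ: "k \<in> J" and k_max: "\<And>j. j \<in> J \<Longrightarrow> j \<le> k"
      unfolding k_def by simp_all
    then have k: "1 \<le> k" "k < \<rho>" using assms(3) by (auto simp: J_def)
    \<comment> \<open>The power with exponent \<open>\<kappa> - 1\<close> dominates; since \<open>0 < \<kappa>\<close>, it also beats the
        logarithmic contribution of order \<open>ln n / n ^ 4\<close>.\<close>
    define \<kappa> where "\<kappa> = real k / real \<rho>"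
    have \<kappa>: "0 < \<kappa>" "\<kappa> < 1" using k by (simp_all add: \<kappa>_def)
    let ?\<phi> = "\<lambda>n. real n powr (\<kappa> - 1 - 3)"
    have lim: "(\<lambda>n. \<mu> k * W k n / ?\<phi> n) \<longlonglongrightarrow> \<mu> k * ((\<kappa> - 1) * (\<kappa> - 1 - 1) * (\<kappa> - 1 - 2))"
      using tendsto_mult_left[OF D3_powr[of "\<kappa> - 1"], of "\<mu> k"]
      by (simp only: W_def \<kappa>_def times_divide_eq_right)
    have c_pos: "\<mu> k * ((\<kappa> - 1) * (\<kappa> - 1 - 1) * (\<kappa> - 1 - 2)) > 0"
      using \<kappa> neg by (intro mult_neg_neg mult_pos_neg) auto
    have "(\<lambda>n. \<mu> j * W j n) \<in> o(?\<phi>)" if "j \<in> {1..<\<rho>} - {k}" for j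
    proof (cases "\<mu> j = 0")
      case False
      with that have "j \<in> J" by (auto simp: J_def)
      with that k_max[of j] have "j < k" by auto
      then have "real j / real \<rho> - 1 - 3 < \<kappa> - 1 - 3"
        using assms(3) by (simp add: \<kappa>_def divide_strict_right_mono)
      from landau_o.big_small_trans[OF W powr_less[OF this]] show ?thesis by simp
    qed simp
    then have "(\<lambda>n. \<Sum>j\<in>{1..<\<rho>} - {k}. \<mu> j * W j n) \<in> o(?\<phi>)"
      by (intro big_sum_in_smallo)
    moreover have "(\<lambda>n. r * Y n) \<in> o(?\<phi>)"
    proof -
      have "(\<lambda>n. ln (real n) * real n powr -4) \<in> o(?\<phi>)" using \<kappa>(1) by real_asymp
      from landau_o.big_small_trans[OF Y this] show ?thesis by simp
    qed
    moreover have "Z \<in> o(?\<phi>)"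
      by (rule landau_o.big_small_trans[OF Z powr_less]) (use \<kappa> in simp)
    ultimately have "(\<lambda>n. (\<Sum>j\<in>{1..<\<rho>} - {k}. \<mu> j * W j n) + r * Y n + Z n) \<in> o(?\<phi>)"
      by (intro sum_in_smallo)
    note nonneg[OF lim c_pos powr_pos this]
    moreover have "(\<Sum>j\<in>{1..<\<rho>}. \<mu> j * W j n)
        = \<mu> k * W k n + (\<Sum>j\<in>{1..<\<rho>} - {k}. \<mu> j * W j n)" for n
      using k by (intro sum.remove) auto
    ultimately show ?thesis
      using \<mu>0 by simp
  next
    assume \<mu>0: "\<mu> 0 = 0" and zero: "\<forall>j\<in>{1..\<rho> - 1}. \<mu> j = 0" and neg: "r < 0"
    \<comment> \<open>All powers are gone, and the factor \<open>ln n\<close> alone decides against the \<open>O(n powr -4)\<close>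
        contribution of \<open>S\<close>.\<close>
    have lim: "(\<lambda>n. r * Y n / (ln (real n) * real n powr -4)) \<longlonglongrightarrow> r * -6"
      using tendsto_mult_left[OF D3_ln_over_id] by (simp add: Y_def)
    have "(\<lambda>n. real n powr -4) \<in> o(\<lambda>n. ln (real n) * real n powr -4)" by real_asymp
    with Z have small: "Z \<in> o(\<lambda>n. ln (real n) * real n powr -4)"
      by (rule landau_o.big_small_trans)
    have pos: "\<forall>\<^sub>F n in sequentially. ln (real n) * real n powr -4 > 0"
      using eventually_gt_at_top[of "1::nat"] by eventually_elim simp
    have "(\<Sum>j\<in>{1..<\<rho>}. \<mu> j * W j n) = 0" for n
      using zero by (intro sum.neutral) auto
    with nonneg[OF lim _ pos small] show ?thesis using neg \<mu>0 by simp
  qed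
  with a_pos show ?thesis by (rule root_asymp_ratio_log_convexI)
qed

end
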